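(* Let $(\Omega,\mathcal{A},\mu)$ be a finite measure space, let $X$ be a Banach space, and let $1\le p<\infty$. If $L^p(\mu,X)$ has the Ball Huskable Property ($BHP$), then $X$ has $BHP$.
   Context: All Banach spaces considered are real and nontrivial (including $L^p(\mu,X)$, so $\mu(\Omega)>0$). $B_X$ is the closed unit ball of $X$. $L^p(\mu,X)$ is the Banach space of (classes of) $p$-integrable Lebesgue-Bochner functions $f:\Omega\to X$ with norm $\|f\|_p=\left(\int_\Omega\|f(t)\|^p\,d\mu(t)\right)^{1/p}$. $X$ has $BHP$ if $B_X$ has nonempty relatively weakly open subsets of arbitrarily small diameter (for every $\varepsilon>0$ there is a nonempty relatively weakly open subset of $B_X$ of diameter less than $\varepsilon$). *)

theory Defs
  imports "HOL-Analysis.Analysis"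
begin

section \<open>Normed spaces with an explicit carrier\<close>

text \<open>
  The space \<open>L\<^sup>p(\<mu>, X)\<close> depends on the measure \<open>\<mu>\<close>, so it is not an instance of
  the type class of normed spaces.  So that one and the same definition of BHP applies to it
  and to \<open>X\<close>, normed spaces are represented by a record of carrier, operations and norm.
\<close>

record 'v normed_struct =
  pts :: "'v set"
  plus_in :: "'v \<Rightarrow> 'v \<Rightarrow> 'v"
  scale_in :: "real \<Rightarrow> 'v \<Rightarrow> 'v"
  norm_in :: "'v \<Rightarrow> real"

definition type_space :: "'a::real_normed_vector normed_struct" where
  "type_space = \<lparr>pts = UNIV, plus_in = (+), scale_in = (*\<^sub>R), norm_in = norm\<rparr>"

definition unit_ball :: "'v normed_struct \<Rightarrow> 'v set" where
  "unit_ball E = {x \<in> pts E. norm_in E x \<le> 1}"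

definition dist_in :: "'v normed_struct \<Rightarrow> 'v \<Rightarrow> 'v \<Rightarrow> real" where
  "dist_in E x y = norm_in E (plus_in E x (scale_in E (-1) y))"

text \<open>Meant for bounded nonempty sets only, as \<open>Sup\<close> on the reals is unspecified otherwise.\<close>

definition diameter_in :: "'v normed_struct \<Rightarrow> 'v set \<Rightarrow> real" where
  "diameter_in E S = (SUP (x, y) \<in> S \<times> S. dist_in E x y)"

definition dual_in :: "'v normed_struct \<Rightarrow> ('v \<Rightarrow> real) set" where
  "dual_in E = {\<phi>.
     (\<forall>x\<in>pts E. \<forall>y\<in>pts E. \<phi> (plus_in E x y) = \<phi> x + \<phi> y) \<and>
     (\<forall>c. \<forall>x\<in>pts E. \<phi> (scale_in E c x) = c * \<phi> x) \<and>
     (\<exists>K. \<forall>x\<in>pts E. \<bar>\<phi> x\<bar> \<le> K * norm_in E x)}"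

definition weak_topology :: "'v normed_struct \<Rightarrow> 'v topology" where
  "weak_topology E = topology_generated_by
     {{x \<in> pts E. \<phi> x \<in> U} | \<phi> U. \<phi> \<in> dual_in E \<and> open U}"

definition BHP :: "'v normed_struct \<Rightarrow> bool" where
  "BHP E \<longleftrightarrow> (\<forall>\<epsilon>>0. \<exists>W.
     openin (subtopology (weak_topology E) (unit_ball E)) W \<and> W \<noteq> {} \<and> diameter_in E W < \<epsilon>)"

lemma topspace_weak_topology: "topspace (weak_topology E) = pts E"
proof -
  have "(\<lambda>_. 0) \<in> dual_in E"
    by (auto simp: dual_in_def intro: exI[of _ 0])
  then have "pts E \<in> {{x \<in> pts E. \<phi> x \<in> U} | \<phi> U. \<phi> \<in> dual_in E \<and> open U}"
    by (auto intro!: exI[of _ "\<lambda>_. 0"] exI[of _ UNIV])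
  then show ?thesis
    by (auto simp: weak_topology_def)
qed

lemma unit_ball_type_space: "unit_ball type_space = cball 0 1"
  by (auto simp: unit_ball_def type_space_def)

lemma dist_in_type_space: "dist_in type_space x y = dist x y"
  by (simp add: dist_in_def type_space_def dist_norm)

lemma diameter_in_type_space: "S \<noteq> {} \<Longrightarrow> diameter_in type_space S = diameter S"
  by (simp add: diameter_in_def diameter_def dist_in_type_space)

lemma dual_in_type_space: "dual_in type_space = Collect bounded_linear"
proof (intro set_eqI iffI)
  fix \<phi> :: "'a \<Rightarrow> real"
  assume "\<phi> \<in> dual_in type_space"
  then obtain K where "\<forall>x. \<bar>\<phi> x\<bar> \<le> K * norm x"
    and "\<And>x y. \<phi> (x + y) = \<phi> x + \<phi> y" "\<And>c x. \<phi> (c *\<^sub>R x) = c * \<phi> x"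
    by (auto simp: dual_in_def type_space_def)
  then show "\<phi> \<in> Collect bounded_linear"
    by (auto intro!: bounded_linear_intro[of \<phi> K] simp: mult.commute)
next
  fix \<phi> :: "'a \<Rightarrow> real"
  assume "\<phi> \<in> Collect bounded_linear"
  then interpret bounded_linear \<phi> by simp
  obtain K where "\<forall>x. norm (\<phi> x) \<le> norm x * K" using bounded by blast
  then show "\<phi> \<in> dual_in type_space"
    by (auto simp: dual_in_def type_space_def add scaleR mult.commute)
qed

section \<open>Lebesgue-Bochner spaces\<close>

text \<open>
  The Bochner integral of the library is confined to second-countable value spaces, whereas \<open>X\<close>
  is arbitrary here; strong measurability is therefore defined directly by simple functions.
  Requiring convergence everywhere instead of almost everywhere does not change the space of
  classes: an almost everywhere limit of simple functions agrees almost everywhere with an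
  everywhere limit of simple functions.
\<close>

definition strongly_measurable :: "'w measure \<Rightarrow> ('w \<Rightarrow> 'a::real_normed_vector) \<Rightarrow> bool" where
  "strongly_measurable M f \<longleftrightarrow>
     (\<exists>s. (\<forall>i. simple_function M (s i)) \<and> (\<forall>t\<in>space M. (\<lambda>i. s i t) \<longlonglongrightarrow> f t))"

definition Lp_fun :: "'w measure \<Rightarrow> real \<Rightarrow> ('w \<Rightarrow> 'a::real_normed_vector) set" where
  "Lp_fun M p = {f. strongly_measurable M f \<and> integrable M (\<lambda>t. norm (f t) powr p)}"

definition Lp_rel :: "'w measure \<Rightarrow> real \<Rightarrow> (('w \<Rightarrow> 'a) \<times> ('w \<Rightarrow> 'a::real_normed_vector)) set" where
  "Lp_rel M p = {(f, g). f \<in> Lp_fun M p \<and> g \<in> Lp_fun M p \<and> (AE t in M. f t = g t)}"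

definition Lp_seminorm :: "'w measure \<Rightarrow> real \<Rightarrow> ('w \<Rightarrow> 'a::real_normed_vector) \<Rightarrow> real" where
  "Lp_seminorm M p f = (LINT t|M. norm (f t) powr p) powr (1 / p)"

definition Lp_space :: "'w measure \<Rightarrow> real \<Rightarrow> ('w \<Rightarrow> 'a::real_normed_vector) set normed_struct" where
  "Lp_space M p =
     \<lparr>pts = Lp_fun M p // Lp_rel M p,
      plus_in = (\<lambda>A B. \<Union>f\<in>A. \<Union>g\<in>B. Lp_rel M p `` {\<lambda>t. f t + g t}),
      scale_in = (\<lambda>c A. \<Union>f\<in>A. Lp_rel M p `` {\<lambda>t. c *\<^sub>R f t}),
      norm_in = (\<lambda>A. the_elem (Lp_seminorm M p ` A))\<rparr>"

lemma strongly_measurable_norm: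
  assumes "strongly_measurable M f"
  shows "(\<lambda>t. norm (f t)) \<in> borel_measurable M"
proof -
  obtain s where s: "\<And>i. simple_function M (s i)" "\<And>t. t \<in> space M \<Longrightarrow> (\<lambda>i. s i t) \<longlonglongrightarrow> f t"
    using assms by (auto simp: strongly_measurable_def)
  show ?thesis
  proof (rule borel_measurable_LIMSEQ_real)
    show "(\<lambda>i. norm (s i t)) \<longlonglongrightarrow> norm (f t)" if "t \<in> space M" for t
      using s(2)[OF that] by (rule tendsto_norm)
    show "(\<lambda>t. norm (s i t)) \<in> borel_measurable M" for i
      using simple_function_compose1[OF s(1), of norm i]
      by (rule borel_measurable_simple_function)
  qed
qed

lemma strongly_measurable_add:
  assumes "strongly_measurable M f" "strongly_measurable M g"
  shows "strongly_measurable M (\<lambda>t. f t + g t)"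
proof -
  obtain s where s: "\<And>i. simple_function M (s i)" "\<And>t. t \<in> space M \<Longrightarrow> (\<lambda>i. s i t) \<longlonglongrightarrow> f t"
    using assms(1) by (auto simp: strongly_measurable_def)
  obtain r where r: "\<And>i. simple_function M (r i)" "\<And>t. t \<in> space M \<Longrightarrow> (\<lambda>i. r i t) \<longlonglongrightarrow> g t"
    using assms(2) by (auto simp: strongly_measurable_def)
  show ?thesis
    unfolding strongly_measurable_def
    by (rule exI[of _ "\<lambda>i t. s i t + r i t"])
      (auto intro!: tendsto_add s r simple_function_compose2[where h = "(+)"])
qed

lemma strongly_measurable_scaleR:
  assumes "strongly_measurable M f"
  shows "strongly_measurable M (\<lambda>t. c *\<^sub>R f t)"
proof -
  obtain s where s: "\<And>i. simple_function M (s i)" "\<And>t. t \<in> space M \<Longrightarrow> (\<lambda>i. s i t) \<longlonglongrightarrow> f t"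
    using assms by (auto simp: strongly_measurable_def)
  show ?thesis
    unfolding strongly_measurable_def
    by (rule exI[of _ "\<lambda>i t. c *\<^sub>R s i t"])
      (auto intro!: tendsto_intros s simple_function_compose1[where g = "scaleR c"])
qed

lemma Lp_fun_scaleR: "f \<in> Lp_fun M p \<Longrightarrow> (\<lambda>t. c *\<^sub>R f t) \<in> Lp_fun M p"
  by (auto simp: Lp_fun_def strongly_measurable_scaleR powr_mult)

lemma Lp_fun_add:
  assumes f: "f \<in> Lp_fun M p" and g: "g \<in> Lp_fun M p" and p: "0 \<le> p"
  shows "(\<lambda>t. f t + g t) \<in> Lp_fun M p"
proof -
  have m: "strongly_measurable M (\<lambda>t. f t + g t)"
    using f g by (auto simp: Lp_fun_def strongly_measurable_add)
  have "integrable M (\<lambda>t. norm (f t + g t) powr p)"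
  proof (rule Bochner_Integration.integrable_bound)
    show "integrable M (\<lambda>t. 2 powr p * (norm (f t) powr p + norm (g t) powr p))"
      using f g by (auto simp: Lp_fun_def)
    show "(\<lambda>t. norm (f t + g t) powr p) \<in> borel_measurable M"
      using strongly_measurable_norm[OF m] by measurable
    have "norm (f t + g t) powr p \<le> 2 powr p * (norm (f t) powr p + norm (g t) powr p)" for t
    proof -
      let ?m = "max (norm (f t)) (norm (g t))"
      have "norm (f t + g t) \<le> 2 * ?m"
        using norm_triangle_ineq[of "f t" "g t"] by linarith
      then have "norm (f t + g t) powr p \<le> (2 * ?m) powr p"
        using p by (intro powr_mono2) auto
      also have "\<dots> = 2 powr p * ?m powr p"
        by (simp add: powr_mult)
      also have "\<dots> \<le> 2 powr p * (norm (f t) powr p + norm (g t) powr p)"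
        by (intro mult_left_mono) (auto simp: max_def)
      finally show ?thesis .
    qed
    then show "AE t in M. norm (norm (f t + g t) powr p)
        \<le> norm (2 powr p * (norm (f t) powr p + norm (g t) powr p))"
      by (auto intro!: order_trans[OF _ abs_ge_self])
  qed
  with m show ?thesis by (simp add: Lp_fun_def)
qed

lemma equiv_Lp_rel: "equiv (Lp_fun M p) (Lp_rel M p)"
proof (rule equivI)
  show "trans (Lp_rel M p)"
    by (rule transI) (auto simp: Lp_rel_def)
qed (auto simp: Lp_rel_def refl_on_def sym_def)

lemma Lp_seminorm_cong:
  assumes "(f, g) \<in> Lp_rel M p"
  shows "Lp_seminorm M p f = Lp_seminorm M p g"
proof -
  have ae: "AE t in M. f t = g t" and "strongly_measurable M f" "strongly_measurable M g"
    using assms by (auto simp: Lp_rel_def Lp_fun_def)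
  then have "(\<lambda>t. norm (f t)) \<in> borel_measurable M" "(\<lambda>t. norm (g t)) \<in> borel_measurable M"
    by (simp_all add: strongly_measurable_norm)
  then have "(LINT t|M. norm (f t) powr p) = (LINT t|M. norm (g t) powr p)"
    using ae by (intro integral_cong_AE) auto
  then show ?thesis by (simp add: Lp_seminorm_def)
qed

lemma plus_in_Lp_space:
  assumes "f \<in> Lp_fun M p" "g \<in> Lp_fun M p" "0 \<le> p"
  shows "plus_in (Lp_space M p) (Lp_rel M p `` {f}) (Lp_rel M p `` {g})
       = Lp_rel M p `` {\<lambda>t. f t + g t}"
proof -
  have "congruent2 (Lp_rel M p) (Lp_rel M p) (\<lambda>f g. Lp_rel M p `` {\<lambda>t. f t + g t :: 'b})"
  proof (rule congruent2I')
    fix f f' g g' :: "'a \<Rightarrow> 'b"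
    assume h: "(f, f') \<in> Lp_rel M p" "(g, g') \<in> Lp_rel M p"
    then have "AE t in M. f t + g t = f' t + g' t"
      by (auto simp: Lp_rel_def)
    with h have "((\<lambda>t. f t + g t), (\<lambda>t. f' t + g' t)) \<in> Lp_rel M p"
      using \<open>0 \<le> p\<close> by (auto simp: Lp_rel_def intro!: Lp_fun_add)
    then show "Lp_rel M p `` {\<lambda>t. f t + g t} = Lp_rel M p `` {\<lambda>t. f' t + g' t}"
      by (rule equiv_class_eq[OF equiv_Lp_rel])
  qed
  then show ?thesis
    using assms by (simp add: Lp_space_def UN_equiv_class2[OF equiv_Lp_rel equiv_Lp_rel])
qed

lemma scale_in_Lp_space:
  assumes "f \<in> Lp_fun M p"
  shows "scale_in (Lp_space M p) c (Lp_rel M p `` {f}) = Lp_rel M p `` {\<lambda>t. c *\<^sub>R f t}"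
proof -
  have "congruent (Lp_rel M p) (\<lambda>f. Lp_rel M p `` {\<lambda>t. c *\<^sub>R f t :: 'b})"
  proof (rule congruentI)
    fix f f' :: "'a \<Rightarrow> 'b"
    assume h: "(f, f') \<in> Lp_rel M p"
    then have "AE t in M. c *\<^sub>R f t = c *\<^sub>R f' t"
      by (auto simp: Lp_rel_def)
    with h have "((\<lambda>t. c *\<^sub>R f t), (\<lambda>t. c *\<^sub>R f' t)) \<in> Lp_rel M p"
      by (auto simp: Lp_rel_def intro!: Lp_fun_scaleR)
    then show "Lp_rel M p `` {\<lambda>t. c *\<^sub>R f t} = Lp_rel M p `` {\<lambda>t. c *\<^sub>R f' t}"
      by (rule equiv_class_eq[OF equiv_Lp_rel])
  qed
  then show ?thesis
    using assms by (simp add: Lp_space_def UN_equiv_class[OF equiv_Lp_rel])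
qed

lemma norm_in_Lp_space:
  assumes "f \<in> Lp_fun M p"
  shows "norm_in (Lp_space M p) (Lp_rel M p `` {f}) = Lp_seminorm M p f"
proof -
  have "f \<in> Lp_rel M p `` {f}" using assms by (simp add: Lp_rel_def)
  moreover have "Lp_seminorm M p g = Lp_seminorm M p f" if "g \<in> Lp_rel M p `` {f}" for g
    using that Lp_seminorm_cong[of f g M p] by simp
  ultimately have "Lp_seminorm M p ` (Lp_rel M p `` {f}) = {Lp_seminorm M p f}"
    by blast
  then show ?thesis by (simp add: Lp_space_def)
qed

end

theory Submission
  imports Defs
begin

text \<open>
  The proof is by contraposition.  Suppose that \<open>X\<close> fails BHP.  By scaling there is \<open>\<eta> > 0\<close> such
  that every weak neighbourhood of a point \<open>x\<close> contains, within any ball \<open>R B\<^sub>X\<close> that contains \<open>x\<close>,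
  two points at distance at least \<open>\<eta> R\<close> (lemma \<open>not_BHP_separated_points\<close>).  The claim is that every
  nonempty relatively weakly open subset \<open>W\<close> of the ball of \<open>L\<^sup>p(\<mu>, X)\<close> then has diameter at least
  \<open>\<eta>\<close>.

  As simple functions are dense, \<open>W\<close> contains a simple function \<open>g\<close>
  (lemma \<open>simple_functions_dense_below\<close>).  For a functional \<open>\<phi>\<close> on \<open>L\<^sup>p(\<mu>, X)\<close> and a value
  \<open>y\<close> of \<open>g\<close>, let \<open>\<Psi> \<phi> y x\<close> be the value of \<open>\<phi>\<close> at the function equal to \<open>x\<close> where \<open>g\<close> is \<open>y\<close>, and
  to zero elsewhere.  As a function of \<open>x\<close> this is a functional on \<open>X\<close>
  (lemma \<open>dual_Lp_piece_bounded_linear\<close>), and \<open>\<phi>\<close> at \<open>u \<circ> g\<close> is the sum over \<open>y\<close> of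
  \<open>\<Psi> \<phi> y (u y)\<close> (lemma \<open>dual_Lp_simple_decomposition\<close>).
  Hence every value \<open>y\<close> of \<open>g\<close> can be replaced
  by two separated points \<open>u y\<close> and \<open>v y\<close> such that the functions \<open>u \<circ> g\<close> and \<open>v \<circ> g\<close> are still in
  the weak neighbourhood of \<open>g\<close> that defines \<open>W\<close>.

  It remains to choose the radii.  Moving \<open>y\<close> only within the ball of radius \<open>\<parallel>y\<parallel>\<close> keeps \<open>u \<circ> g\<close> and
  \<open>v \<circ> g\<close> in the unit ball, but separates them only by \<open>\<eta> \<parallel>g\<parallel>\<^sub>p\<close>, which may be tiny.
  Instead, let \<open>R(y)\<^sup>p = \<parallel>y\<parallel>\<^sup>p + c\<close>, where \<open>c = (1 - \<parallel>g\<parallel>\<^sub>p\<^sup>p) / \<mu>(\<Omega>)\<close>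
  spreads the mass that \<open>g\<close> lacks evenly over \<open>\<Omega>\<close>.  Then \<open>R(y) \<ge> \<parallel>y\<parallel>\<close> and \<open>\<integral> R(g)\<^sup>p d\<mu> = 1\<close>
  exactly, so both functions lie in the unit ball, at distance at least \<open>\<eta>\<close>.
\<close>

section \<open>Weak neighbourhoods\<close>

lemma openin_weak_topology_basic_nhd:
  assumes "openin (weak_topology E) U" "x \<in> U"
  shows "\<exists>F \<delta>. finite F \<and> F \<subseteq> dual_in E \<and> 0 < \<delta> \<and>
           (\<forall>y\<in>pts E. (\<forall>\<phi>\<in>F. \<bar>\<phi> y - \<phi> x\<bar> < \<delta>) \<longrightarrow> y \<in> U)"
proof -
  have "generate_topology_on {{x \<in> pts E. \<phi> x \<in> U} | \<phi> U. \<phi> \<in> dual_in E \<and> open U} U"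
    using assms(1) by (simp add: weak_topology_def openin_topology_generated_by_iff)
  then show ?thesis
    using assms(2)
  proof induction
    case Empty
    then show ?case by simp
  next
    case (Int a b)
    then obtain F \<delta> G \<gamma> where
      F: "finite F" "F \<subseteq> dual_in E" "0 < \<delta>" "\<forall>y\<in>pts E. (\<forall>\<phi>\<in>F. \<bar>\<phi> y - \<phi> x\<bar> < \<delta>) \<longrightarrow> y \<in> a" and
      G: "finite G" "G \<subseteq> dual_in E" "0 < \<gamma>" "\<forall>y\<in>pts E. (\<forall>\<phi>\<in>G. \<bar>\<phi> y - \<phi> x\<bar> < \<gamma>) \<longrightarrow> y \<in> b"
      by auto
    have "\<forall>y\<in>pts E. (\<forall>\<phi>\<in>F \<union> G. \<bar>\<phi> y - \<phi> x\<bar> < min \<delta> \<gamma>) \<longrightarrow> y \<in> a \<inter> b"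
      using F(4) G(4) by auto
    then show ?case
      using F G by (intro exI[of _ "F \<union> G"] exI[of _ "min \<delta> \<gamma>"]) auto
  next
    case (UN K)
    then obtain k where "k \<in> K" "x \<in> k" by blast
    with UN.IH[of k] show ?case
      by (meson UnionI)
  next
    case (Basis s)
    then obtain \<phi> V where s: "s = {x \<in> pts E. \<phi> x \<in> V}" "\<phi> \<in> dual_in E" "open V"
      by blast
    with Basis.prems obtain \<delta> where "0 < \<delta>" "ball (\<phi> x) \<delta> \<subseteq> V"
      by (auto simp: open_contains_ball)
    then have "\<forall>y\<in>pts E. (\<forall>\<psi>\<in>{\<phi>}. \<bar>\<psi> y - \<psi> x\<bar> < \<delta>) \<longrightarrow> y \<in> s"
      by (auto simp: s dist_real_def abs_minus_commute subset_eq)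
    then show ?case
      using s \<open>0 < \<delta>\<close> by (intro exI[of _ "{\<phi>}"] exI[of _ \<delta>]) auto
  qed
qed

lemma openin_weak_topology_finite_conditions:
  assumes "finite F" "F \<subseteq> dual_in E"
  shows "openin (weak_topology E) {y \<in> pts E. \<forall>\<phi>\<in>F. \<bar>\<phi> y - a \<phi>\<bar> < \<delta>}"
  using assms
proof (induction F)
  case empty
  then show ?case
    using openin_topspace[of "weak_topology E"] by (simp add: topspace_weak_topology)
next
  case (insert \<phi> F)
  have "openin (weak_topology E) {y \<in> pts E. \<phi> y \<in> ball (a \<phi>) \<delta>}"
    unfolding weak_topology_def
    using insert.prems by (intro topology_generated_by_Basis) blast
  moreover have "{y \<in> pts E. \<forall>\<psi>\<in>insert \<phi> F. \<bar>\<psi> y - a \<psi>\<bar> < \<delta>}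
      = {y \<in> pts E. \<phi> y \<in> ball (a \<phi>) \<delta>} \<inter> {y \<in> pts E. \<forall>\<psi>\<in>F. \<bar>\<psi> y - a \<psi>\<bar> < \<delta>}"
    by (auto simp: dist_real_def abs_minus_commute)
  ultimately show ?case
    using insert by (auto intro: openin_Int)
qed

text \<open>
  A set of diameter at least \<open>\<epsilon>\<close> contains two points at distance more than \<open>\<epsilon> / 2\<close>; dividing by \<open>R\<close>
  carries the statement from the unit ball to the ball of radius \<open>R\<close>.
\<close>

lemma not_BHP_separated_points:
  assumes "\<not> BHP (type_space :: 'a::real_normed_vector normed_struct)"
  obtains \<eta> where "0 < \<eta>"
    and "\<And>(F :: ('a \<Rightarrow> real) set) x R \<delta>. \<lbrakk>finite F; \<And>\<psi>. \<psi> \<in> F \<Longrightarrow> bounded_linear \<psi>; norm x \<le> R; 0 < \<delta>\<rbrakk> \<Longrightarrow>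
      \<exists>u v. norm u \<le> R \<and> norm v \<le> R \<and> \<eta> * R \<le> norm (u - v) \<and>
        (\<forall>\<psi>\<in>F. \<bar>\<psi> u - \<psi> x\<bar> < \<delta> \<and> \<bar>\<psi> v - \<psi> x\<bar> < \<delta>)"
proof -
  let ?X = "type_space :: 'a normed_struct"
  obtain \<epsilon> where "0 < \<epsilon>" and big: "\<And>W. openin (subtopology (weak_topology ?X) (unit_ball ?X)) W
      \<Longrightarrow> W \<noteq> {} \<Longrightarrow> \<epsilon> \<le> diameter_in ?X W"
    using assms by (auto simp: BHP_def not_less)
  have "\<exists>u v. norm u \<le> R \<and> norm v \<le> R \<and> \<epsilon> / 2 * R \<le> norm (u - v) \<and>
        (\<forall>\<psi>\<in>F. \<bar>\<psi> u - \<psi> x\<bar> < \<delta> \<and> \<bar>\<psi> v - \<psi> x\<bar> < \<delta>)"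
    if F: "finite F" "\<And>\<psi>. \<psi> \<in> F \<Longrightarrow> bounded_linear \<psi>" and x: "norm x \<le> R" and "0 < \<delta>"
    for F :: "('a \<Rightarrow> real) set" and x R \<delta>
  proof (cases "R = 0")
    case True
    with x \<open>0 < \<delta>\<close> show ?thesis
      by (intro exI[of _ x]) auto
  next
    case False
    with x have "0 < R"
      using norm_ge_zero[of x] by linarith
    define N where "N = {y \<in> pts ?X. \<forall>\<psi>\<in>F. \<bar>\<psi> y - \<psi> (x /\<^sub>R R)\<bar> < \<delta> / R}"
    define W where "W = N \<inter> unit_ball ?X"
    have "openin (weak_topology ?X) N"
      unfolding N_def using F
      by (intro openin_weak_topology_finite_conditions) (auto simp: dual_in_type_space)
    then have "openin (subtopology (weak_topology ?X) (unit_ball ?X)) W"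
      by (auto simp: openin_subtopology W_def)
    moreover have "x /\<^sub>R R \<in> N"
      using \<open>0 < R\<close> \<open>0 < \<delta>\<close> by (auto simp: N_def type_space_def)
    moreover have "x /\<^sub>R R \<in> unit_ball ?X"
      using \<open>0 < R\<close> x by (simp add: unit_ball_type_space field_simps)
    ultimately have "\<epsilon> \<le> diameter_in ?X W" and "W \<noteq> {}"
      using big by (auto simp: W_def)
    have "\<exists>a\<in>W. \<exists>b\<in>W. \<epsilon> / 2 < dist a b"
    proof (rule ccontr)
      assume "\<not> ?thesis"
      then have "diameter_in ?X W \<le> \<epsilon> / 2"
        unfolding diameter_in_def using \<open>W \<noteq> {}\<close>
        by (intro cSUP_least) (auto simp: dist_in_type_space not_less)
      with \<open>\<epsilon> \<le> diameter_in ?X W\<close> \<open>0 < \<epsilon>\<close> show False by simp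
    qed
    then obtain a b where ab: "a \<in> W" "b \<in> W" "\<epsilon> / 2 < dist a b" by blast
    have rescaled: "norm (R *\<^sub>R w) \<le> R \<and> (\<forall>\<psi>\<in>F. \<bar>\<psi> (R *\<^sub>R w) - \<psi> x\<bar> < \<delta>)" if "w \<in> W" for w
    proof (intro conjI ballI)
      show "norm (R *\<^sub>R w) \<le> R"
        using that \<open>0 < R\<close> by (simp add: W_def unit_ball_type_space)
      fix \<psi> assume "\<psi> \<in> F"
      then interpret bounded_linear \<psi> by (rule F(2))
      have "\<psi> (x /\<^sub>R R) = \<psi> x / R"
        by (simp add: scaleR divide_inverse)
      moreover have "\<bar>\<psi> w - \<psi> (x /\<^sub>R R)\<bar> < \<delta> / R"
        using that \<open>\<psi> \<in> F\<close> unfolding W_def N_def by blast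
      ultimately have "\<bar>\<psi> w - \<psi> x / R\<bar> < \<delta> / R" by simp
      then have "R * \<bar>\<psi> w - \<psi> x / R\<bar> < \<delta>"
        using \<open>0 < R\<close> by (simp add: pos_less_divide_eq mult.commute)
      moreover have "\<psi> (R *\<^sub>R w) - \<psi> x = R * (\<psi> w - \<psi> x / R)"
        using \<open>0 < R\<close> by (simp add: scaleR right_diff_distrib)
      ultimately show "\<bar>\<psi> (R *\<^sub>R w) - \<psi> x\<bar> < \<delta>"
        using \<open>0 < R\<close> by (simp add: abs_mult)
    qed
    have "norm (R *\<^sub>R a - R *\<^sub>R b) = norm (R *\<^sub>R (a - b))"
      by (simp only: scaleR_right_diff_distrib)
    also have "\<dots> = R * dist a b"
      using \<open>0 < R\<close> by (simp add: dist_norm)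
    finally have "\<epsilon> / 2 * R \<le> norm (R *\<^sub>R a - R *\<^sub>R b)"
      using ab(3) \<open>0 < R\<close> by (simp add: mult.commute)
    then show ?thesis
      using rescaled[OF ab(1)] rescaled[OF ab(2)] by blast
  qed
  with \<open>0 < \<epsilon>\<close> that[of "\<epsilon> / 2"] show ?thesis by simp
qed

section \<open>Functions in Lebesgue-Bochner spaces\<close>

lemma norm_diff_powr_le:
  fixes x y :: "'a::real_normed_vector"
  assumes "0 \<le> p"
  shows "norm (x - y) powr p \<le> 2 powr p * (norm x powr p + norm y powr p)"
proof -
  let ?m = "max (norm x) (norm y)"
  have "norm (x - y) \<le> 2 * ?m"
    using norm_triangle_ineq4[of x y] by linarith
  then have "norm (x - y) powr p \<le> (2 * ?m) powr p"
    using assms by (intro powr_mono2) auto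
  also have "\<dots> = 2 powr p * ?m powr p"
    by (simp add: powr_mult)
  also have "\<dots> \<le> 2 powr p * (norm x powr p + norm y powr p)"
    by (intro mult_left_mono) (auto simp: max_def)
  finally show ?thesis .
qed

lemma Lp_fun_diff:
  assumes "f \<in> Lp_fun M p" "g \<in> Lp_fun M p" "0 \<le> p"
  shows "(\<lambda>t. f t - g t) \<in> Lp_fun M p"
  using Lp_fun_add[OF assms(1) Lp_fun_scaleR[OF assms(2), of "-1"] assms(3)] by simp

lemma simple_function_strongly_measurable:
  "simple_function M f \<Longrightarrow> strongly_measurable M f"
  unfolding strongly_measurable_def by (intro exI[of _ "\<lambda>_. f"]) auto

lemma simple_function_in_Lp_fun:
  assumes "finite_measure M" "simple_function M f"
  shows "f \<in> Lp_fun M p"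
proof -
  interpret finite_measure M by fact
  have s: "simple_function M (\<lambda>t. norm (f t) powr p)"
    by (rule simple_function_compose1[OF assms(2)])
  let ?B = "Max ((\<lambda>t. norm (f t) powr p) ` space M)"
  have "AE t in M. norm (norm (f t) powr p) \<le> ?B"
    using simple_functionD(1)[OF s] by (intro AE_I2) auto
  then have "integrable M (\<lambda>t. norm (f t) powr p)"
    using borel_measurable_simple_function[OF s] by (rule integrable_const_bound)
  with assms(2) show ?thesis
    by (simp add: Lp_fun_def simple_function_strongly_measurable)
qed

lemma Lp_seminorm_le_1_iff:
  assumes "0 < p"
  shows "Lp_seminorm M p f \<le> 1 \<longleftrightarrow> (LINT t|M. norm (f t) powr p) \<le> 1"
proof -
  have "Lp_seminorm M p f \<le> 1 \<longleftrightarrow> Lp_seminorm M p f powr p \<le> 1 powr p"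
    using assms by (metis Lp_seminorm_def less_le_not_le linorder_le_less_linear powr_ge_zero
        powr_less_mono2 powr_mono2 zero_le_one)
  also have "Lp_seminorm M p f powr p = (LINT t|M. norm (f t) powr p)"
    using assms by (simp add: Lp_seminorm_def powr_powr)
  finally show ?thesis by simp
qed

text \<open>
  Let \<open>s i\<close> be simple functions that converge to \<open>f\<close> pointwise.  Shortening \<open>s i t\<close> to a length at
  most \<open>h i t\<close>, where the \<open>h i\<close> are real simple functions that increase to \<open>\<parallel>f\<parallel>\<close>, gives simple
  approximations that \<open>\<parallel>f\<parallel>\<close> dominates.  They converge in \<open>L\<^sup>p\<close> by dominated convergence, and their
  norms do not exceed that of \<open>f\<close>.
\<close>

lemma simple_functions_dense_below:
  fixes f :: "'w \<Rightarrow> 'a::real_normed_vector"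
  assumes f: "f \<in> Lp_fun M p" and "0 < p"
  obtains g where "\<And>i. simple_function M (g i)"
    and "\<And>i t. norm (g i t) \<le> norm (f t)"
    and "(\<lambda>i. Lp_seminorm M p (\<lambda>t. g i t - f t)) \<longlonglongrightarrow> 0"
proof -
  have mf: "strongly_measurable M f" and int: "integrable M (\<lambda>t. norm (f t) powr p)"
    using f by (auto simp: Lp_fun_def)
  obtain s where s: "\<And>i. simple_function M (s i)" "\<And>t. t \<in> space M \<Longrightarrow> (\<lambda>i. s i t) \<longlonglongrightarrow> f t"
    using mf by (auto simp: strongly_measurable_def)
  obtain h where h: "incseq h" "\<And>i. simple_function M (h i)"
      "\<And>t. bdd_above (range (\<lambda>i. h i t))" "\<And>i t. 0 \<le> h i t"
      and sup: "(\<lambda>t. norm (f t)) = (SUP i. h i)"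
    using borel_measurable_implies_simple_function_sequence_real
        [OF strongly_measurable_norm[OF mf] norm_ge_zero] by blast
  have sup': "norm (f t) = (SUP i. h i t)" for t
    using fun_cong[OF sup, of t] by (simp add: SUP_apply image_comp)
  have h_le: "h i t \<le> norm (f t)" for i t
    unfolding sup' using h(3) by (intro cSUP_upper) auto
  have h_lim: "(\<lambda>i. h i t) \<longlonglongrightarrow> norm (f t)" for t
    unfolding sup' using h(1) by (intro LIMSEQ_incseq_SUP h(3)) (auto simp: incseq_def le_fun_def)
  define g where "g i t = (h i t / max (h i t) (norm (s i t))) *\<^sub>R s i t" for i t
  have g_simple: "simple_function M (g i)" for i
    unfolding g_def [abs_def]
    by (rule simple_function_compose2[OF h(2) s(1), of "\<lambda>a x. (a / max a (norm x)) *\<^sub>R x"])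
  have g_le_h: "norm (g i t) \<le> h i t" for i t
  proof -
    have "norm (g i t) = h i t * (norm (s i t) / max (h i t) (norm (s i t)))"
      using h(4)[of i t] by (simp add: g_def)
    also have "\<dots> \<le> h i t * 1"
      using h(4)[of i t] by (intro mult_left_mono) (auto simp: divide_le_eq_1 max_def)
    finally show ?thesis by simp
  qed
  have g_le: "norm (g i t) \<le> norm (f t)" for i t
    using g_le_h h_le by (rule order_trans)
  have g_lim: "(\<lambda>i. g i t) \<longlonglongrightarrow> f t" if "t \<in> space M" for t
  proof (cases "f t = 0")
    case True
    then have "g i t = 0" for i
      using g_le[of i t] by simp
    with True show ?thesis by simp
  next
    case False
    have "(\<lambda>i. max (h i t) (norm (s i t))) \<longlonglongrightarrow> max (norm (f t)) (norm (f t))"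
      by (intro tendsto_max tendsto_norm h_lim s(2) that)
    then have "(\<lambda>i. (h i t / max (h i t) (norm (s i t))) *\<^sub>R s i t)
        \<longlonglongrightarrow> (norm (f t) / norm (f t)) *\<^sub>R f t"
      using False by (intro tendsto_scaleR tendsto_divide h_lim s(2) that) auto
    with False show ?thesis by (simp add: g_def)
  qed
  have diff: "strongly_measurable M (\<lambda>t. g i t - f t)" for i
    using strongly_measurable_add[OF simple_function_strongly_measurable[OF g_simple]
        strongly_measurable_scaleR[OF mf, of "-1"]] by simp
  have "(\<lambda>i. LINT t|M. norm (g i t - f t) powr p) \<longlonglongrightarrow> (LINT t|M. 0)"
  proof (rule integral_dominated_convergence)
    show "integrable M (\<lambda>t. 2 powr p * (norm (f t) powr p + norm (f t) powr p))"
      using int by auto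
    show "(\<lambda>t. norm (g i t - f t) powr p) \<in> borel_measurable M" for i
      using strongly_measurable_norm[OF diff] by measurable
    show "AE t in M. (\<lambda>i. norm (g i t - f t) powr p) \<longlonglongrightarrow> 0"
    proof (rule AE_I2)
      fix t assume "t \<in> space M"
      then have "(\<lambda>i. norm (g i t - f t)) \<longlonglongrightarrow> 0"
        using g_lim by (simp add: LIM_zero tendsto_norm_zero)
      then show "(\<lambda>i. norm (g i t - f t) powr p) \<longlonglongrightarrow> 0"
        using \<open>0 < p\<close> by (intro tendsto_zero_powrI[where b = p]) auto
    qed
    show "AE t in M. norm (norm (g i t - f t) powr p)
        \<le> 2 powr p * (norm (f t) powr p + norm (f t) powr p)" for i
    proof (rule AE_I2)
      fix t
      have "norm (g i t) powr p \<le> norm (f t) powr p"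
        using g_le \<open>0 < p\<close> by (intro powr_mono2) auto
      then show "norm (norm (g i t - f t) powr p)
          \<le> 2 powr p * (norm (f t) powr p + norm (f t) powr p)"
        using norm_diff_powr_le[of p "g i t" "f t"] \<open>0 < p\<close>
        by (auto elim!: order_trans intro!: mult_left_mono)
    qed
  qed auto
  then have "(\<lambda>i. Lp_seminorm M p (\<lambda>t. g i t - f t)) \<longlonglongrightarrow> 0"
    unfolding Lp_seminorm_def using \<open>0 < p\<close>
    by (intro tendsto_zero_powrI[where b = "1 / p"]) auto
  with g_simple g_le show ?thesis by (rule that)
qed

section \<open>Classes of functions and functionals on them\<close>

abbreviation Lp_class :: "'w measure \<Rightarrow> real \<Rightarrow> ('w \<Rightarrow> 'a::real_normed_vector) \<Rightarrow> ('w \<Rightarrow> 'a) set"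
  where "Lp_class M p f \<equiv> Lp_rel M p `` {f}"

lemma Lp_class_in_pts: "f \<in> Lp_fun M p \<Longrightarrow> Lp_class M p f \<in> pts (Lp_space M p)"
  by (simp add: Lp_space_def quotientI)

lemma pts_Lp_space_cases:
  assumes "A \<in> pts (Lp_space M p)"
  obtains f where "f \<in> Lp_fun M p" "A = Lp_class M p f"
  using assms by (auto simp: Lp_space_def elim!: quotientE)

lemma Lp_class_cong:
  assumes "f \<in> Lp_fun M p" "g \<in> Lp_fun M p" "\<And>t. t \<in> space M \<Longrightarrow> f t = g t"
  shows "Lp_class M p f = Lp_class M p g"
  using assms by (intro equiv_class_eq[OF equiv_Lp_rel]) (auto simp: Lp_rel_def)

lemma Lp_class_in_unit_ball_iff:
  assumes "f \<in> Lp_fun M p" "0 < p"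
  shows "Lp_class M p f \<in> unit_ball (Lp_space M p) \<longleftrightarrow> (LINT t|M. norm (f t) powr p) \<le> 1"
  using assms by (simp add: unit_ball_def Lp_class_in_pts norm_in_Lp_space Lp_seminorm_le_1_iff)

lemma dist_in_Lp_space:
  assumes "f \<in> Lp_fun M p" "g \<in> Lp_fun M p" "0 \<le> p"
  shows "dist_in (Lp_space M p) (Lp_class M p f) (Lp_class M p g)
       = Lp_seminorm M p (\<lambda>t. f t - g t)"
proof -
  have "(\<lambda>t. (-1) *\<^sub>R g t) \<in> Lp_fun M p"
    using assms(2) by (rule Lp_fun_scaleR)
  then show ?thesis
    using Lp_fun_diff[OF assms] assms
    by (simp add: dist_in_def scale_in_Lp_space plus_in_Lp_space norm_in_Lp_space)
qed

text \<open>
  The distances within the unit ball are bounded, so that the supremum defining the diameter is a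
  genuine one.  The crude estimate \<open>\<parallel>x - y\<parallel>\<^sup>p \<le> 2\<^sup>p (\<parallel>x\<parallel>\<^sup>p + \<parallel>y\<parallel>\<^sup>p)\<close> suffices for that, in place of
  the triangle inequality of \<open>L\<^sup>p\<close>.
\<close>

lemma dist_in_le_diameter_in_Lp_space:
  assumes "W \<subseteq> unit_ball (Lp_space M p)" "A \<in> W" "B \<in> W" "0 < p"
  shows "dist_in (Lp_space M p) A B \<le> diameter_in (Lp_space M p) W"
proof -
  have "dist_in (Lp_space M p) C D \<le> (2 powr p * 2) powr (1 / p)" if "C \<in> W" "D \<in> W" for C D
  proof -
    have "C \<in> unit_ball (Lp_space M p)" "D \<in> unit_ball (Lp_space M p)"
      using that assms(1) by auto
    moreover from this obtain f g where fg: "f \<in> Lp_fun M p" "C = Lp_class M p f"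
        "g \<in> Lp_fun M p" "D = Lp_class M p g"
      by (auto simp: unit_ball_def elim!: pts_Lp_space_cases)
    ultimately have "(LINT t|M. norm (f t) powr p) \<le> 1" "(LINT t|M. norm (g t) powr p) \<le> 1"
      using \<open>0 < p\<close> by (simp_all add: Lp_class_in_unit_ball_iff)
    have int: "integrable M (\<lambda>t. norm (f t) powr p)" "integrable M (\<lambda>t. norm (g t) powr p)"
      "integrable M (\<lambda>t. norm (f t - g t) powr p)"
      using fg Lp_fun_diff[of f M p g] \<open>0 < p\<close> by (auto simp: Lp_fun_def)
    have "(LINT t|M. norm (f t - g t) powr p)
        \<le> (LINT t|M. 2 powr p * (norm (f t) powr p + norm (g t) powr p))"
      using int \<open>0 < p\<close> by (intro integral_mono norm_diff_powr_le) auto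
    also have "\<dots> = 2 powr p * ((LINT t|M. norm (f t) powr p) + (LINT t|M. norm (g t) powr p))"
      using int by simp
    also have "\<dots> \<le> 2 powr p * 2"
      using \<open>(LINT t|M. norm (f t) powr p) \<le> 1\<close> \<open>(LINT t|M. norm (g t) powr p) \<le> 1\<close>
      by (intro mult_left_mono) auto
    finally have "Lp_seminorm M p (\<lambda>t. f t - g t) \<le> (2 powr p * 2) powr (1 / p)"
      unfolding Lp_seminorm_def using \<open>0 < p\<close> by (intro powr_mono2) auto
    with fg \<open>0 < p\<close> show ?thesis by (simp add: dist_in_Lp_space)
  qed
  then have "bdd_above ((\<lambda>(C, D). dist_in (Lp_space M p) C D) ` (W \<times> W))"
    by (intro bdd_aboveI2[where M = "(2 powr p * 2) powr (1 / p)"]) auto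
  with assms show ?thesis
    unfolding diameter_in_def by (intro cSUP_upper2[where x = "(A, B)"]) auto
qed

lemma dual_Lp_add:
  assumes "\<phi> \<in> dual_in (Lp_space M p)" "f \<in> Lp_fun M p" "g \<in> Lp_fun M p" "0 \<le> p"
  shows "\<phi> (Lp_class M p (\<lambda>t. f t + g t)) = \<phi> (Lp_class M p f) + \<phi> (Lp_class M p g)"
proof -
  have "\<phi> (plus_in (Lp_space M p) (Lp_class M p f) (Lp_class M p g))
      = \<phi> (Lp_class M p f) + \<phi> (Lp_class M p g)"
    using assms(1) Lp_class_in_pts[OF assms(2)] Lp_class_in_pts[OF assms(3)]
    unfolding dual_in_def by blast
  with assms show ?thesis by (simp add: plus_in_Lp_space)
qed

lemma dual_Lp_scaleR:
  assumes "\<phi> \<in> dual_in (Lp_space M p)" "f \<in> Lp_fun M p"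
  shows "\<phi> (Lp_class M p (\<lambda>t. c *\<^sub>R f t)) = c * \<phi> (Lp_class M p f)"
proof -
  have "\<phi> (scale_in (Lp_space M p) c (Lp_class M p f)) = c * \<phi> (Lp_class M p f)"
    using assms(1) Lp_class_in_pts[OF assms(2)] unfolding dual_in_def by blast
  with assms show ?thesis by (simp add: scale_in_Lp_space)
qed

lemma dual_Lp_diff:
  assumes "\<phi> \<in> dual_in (Lp_space M p)" "f \<in> Lp_fun M p" "g \<in> Lp_fun M p" "0 \<le> p"
  shows "\<phi> (Lp_class M p (\<lambda>t. f t - g t)) = \<phi> (Lp_class M p f) - \<phi> (Lp_class M p g)"
  using dual_Lp_add[OF assms(1,2) Lp_fun_scaleR[OF assms(3), of "-1"] assms(4)]
    dual_Lp_scaleR[OF assms(1,3), of "-1"] by simp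

lemma dual_Lp_bounded:
  assumes "\<phi> \<in> dual_in (Lp_space M p)"
  obtains K where "0 \<le> K" "\<And>f. f \<in> Lp_fun M p \<Longrightarrow> \<bar>\<phi> (Lp_class M p f)\<bar> \<le> K * Lp_seminorm M p f"
proof -
  obtain K where K: "\<forall>A\<in>pts (Lp_space M p). \<bar>\<phi> A\<bar> \<le> K * norm_in (Lp_space M p) A"
    using assms unfolding dual_in_def by blast
  have "\<bar>\<phi> (Lp_class M p f)\<bar> \<le> \<bar>K\<bar> * Lp_seminorm M p f" if "f \<in> Lp_fun M p" for f
  proof -
    have "\<bar>\<phi> (Lp_class M p f)\<bar> \<le> K * Lp_seminorm M p f"
      using bspec[OF K Lp_class_in_pts[OF that]] that by (simp add: norm_in_Lp_space)
    also have "\<dots> \<le> \<bar>K\<bar> * Lp_seminorm M p f"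
      by (intro mult_right_mono) (auto simp: Lp_seminorm_def)
    finally show ?thesis .
  qed
  then show ?thesis by (intro that[of "\<bar>K\<bar>"]) auto
qed

lemma dual_Lp_sum:
  assumes \<phi>: "\<phi> \<in> dual_in (Lp_space M p)" and "0 \<le> p"
    and "finite S" "\<And>y. y \<in> S \<Longrightarrow> f y \<in> Lp_fun M p"
  shows "(\<lambda>t. \<Sum>y\<in>S. f y t) \<in> Lp_fun M p \<and>
    \<phi> (Lp_class M p (\<lambda>t. \<Sum>y\<in>S. f y t)) = (\<Sum>y\<in>S. \<phi> (Lp_class M p (f y)))"
  using assms(3,4)
proof (induction S)
  case empty
  have zero: "(\<lambda>_. 0) \<in> Lp_fun M p"
    by (simp add: Lp_fun_def simple_function_strongly_measurable)
  then show ?case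
    using dual_Lp_scaleR[OF \<phi> zero, of 0] by simp
next
  case (insert y S)
  then show ?case
    using dual_Lp_add[OF \<phi>, of "f y" "\<lambda>t. \<Sum>y\<in>S. f y t"] \<open>0 \<le> p\<close> by (auto intro: Lp_fun_add)
qed

lemma simple_function_piece:
  "simple_function M g \<Longrightarrow> simple_function M (\<lambda>t. if g t = y then x else 0)"
  by (rule simple_function_compose1[where g = "\<lambda>z. if z = y then x else 0"])

text \<open>
  The norm of the function equal to \<open>x\<close> on a set and to zero off it is at most
  \<open>\<parallel>x\<parallel> \<mu>(\<Omega>)\<^bsup>1/p\<^esup>\<close>, whence the bound.
\<close>

lemma dual_Lp_piece_bounded_linear:
  fixes g :: "'w \<Rightarrow> 'b" and \<phi> :: "('w \<Rightarrow> 'a::real_normed_vector) set \<Rightarrow> real"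
  assumes M: "finite_measure M" and \<phi>: "\<phi> \<in> dual_in (Lp_space M p)" and "0 < p"
    and g: "simple_function M g"
  shows "bounded_linear (\<lambda>x. \<phi> (Lp_class M p (\<lambda>t. if g t = y then x else 0)))"
proof -
  interpret finite_measure M by fact
  have Lp: "(\<lambda>t. if g t = y then x else 0) \<in> Lp_fun M p" for x :: 'a
    by (rule simple_function_in_Lp_fun[OF M simple_function_piece[OF g]])
  obtain K where K: "0 \<le> K"
      "\<And>f. f \<in> Lp_fun M p \<Longrightarrow> \<bar>\<phi> (Lp_class M p f)\<bar> \<le> K * Lp_seminorm M p f"
    using dual_Lp_bounded[OF \<phi>] by blast
  show ?thesis
  proof (rule bounded_linear_intro)
    fix x z :: 'a and c :: real
    have "(\<lambda>t. if g t = y then x + z else 0)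
        = (\<lambda>t. (if g t = y then x else 0) + (if g t = y then z else 0))"
      by auto
    then show "\<phi> (Lp_class M p (\<lambda>t. if g t = y then x + z else 0))
        = \<phi> (Lp_class M p (\<lambda>t. if g t = y then x else 0))
          + \<phi> (Lp_class M p (\<lambda>t. if g t = y then z else 0))"
      using dual_Lp_add[OF \<phi> Lp Lp] \<open>0 < p\<close> by simp
    have "(\<lambda>t. if g t = y then c *\<^sub>R x else 0) = (\<lambda>t. c *\<^sub>R (if g t = y then x else 0))"
      by auto
    then show "\<phi> (Lp_class M p (\<lambda>t. if g t = y then c *\<^sub>R x else 0))
        = c *\<^sub>R \<phi> (Lp_class M p (\<lambda>t. if g t = y then x else 0))"
      using dual_Lp_scaleR[OF \<phi> Lp] by simp
    have "(LINT t|M. norm (if g t = y then x else 0) powr p) \<le> (LINT t|M. norm x powr p)"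
      using Lp[of x] by (intro integral_mono) (auto simp: Lp_fun_def)
    also have "\<dots> = norm x powr p * measure M (space M)"
      by simp
    finally have "Lp_seminorm M p (\<lambda>t. if g t = y then x else 0)
        \<le> (norm x powr p * measure M (space M)) powr (1 / p)"
      unfolding Lp_seminorm_def using \<open>0 < p\<close> by (intro powr_mono2) auto
    also have "\<dots> = norm x * measure M (space M) powr (1 / p)"
      using \<open>0 < p\<close> by (simp add: powr_mult powr_powr)
    finally have "K * Lp_seminorm M p (\<lambda>t. if g t = y then x else 0)
        \<le> norm x * (K * measure M (space M) powr (1 / p))"
      using mult_left_mono[OF _ K(1)] by (simp add: mult.left_commute)
    with K(2)[OF Lp[of x]] show "norm (\<phi> (Lp_class M p (\<lambda>t. if g t = y then x else 0)))
        \<le> norm x * (K * measure M (space M) powr (1 / p))"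
      unfolding real_norm_def by (rule order_trans)
  qed
qed

text \<open>
  On the space, \<open>u \<circ> g\<close> is the sum over the values \<open>y\<close> of \<open>g\<close> of the function equal to \<open>u y\<close> where
  \<open>g\<close> is \<open>y\<close>, and to zero elsewhere.
\<close>

lemma dual_Lp_simple_decomposition:
  fixes g :: "'w \<Rightarrow> 'b" and u :: "'b \<Rightarrow> 'a::real_normed_vector"
  assumes M: "finite_measure M" and \<phi>: "\<phi> \<in> dual_in (Lp_space M p)" and "0 < p"
    and g: "simple_function M g"
  shows "\<phi> (Lp_class M p (\<lambda>t. u (g t)))
    = (\<Sum>y\<in>g ` space M. \<phi> (Lp_class M p (\<lambda>t. if g t = y then u y else 0)))"
proof -
  have fin: "finite (g ` space M)"
    using g by (rule simple_functionD)
  have Lp: "(\<lambda>t. if g t = y then u y else 0) \<in> Lp_fun M p" for y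
    by (rule simple_function_in_Lp_fun[OF M simple_function_piece[OF g]])
  have sum: "(\<lambda>t. \<Sum>y\<in>g ` space M. if g t = y then u y else 0) \<in> Lp_fun M p"
    "\<phi> (Lp_class M p (\<lambda>t. \<Sum>y\<in>g ` space M. if g t = y then u y else 0))
      = (\<Sum>y\<in>g ` space M. \<phi> (Lp_class M p (\<lambda>t. if g t = y then u y else 0)))"
    using dual_Lp_sum[OF \<phi> _ fin Lp] \<open>0 < p\<close> by auto
  have "Lp_class M p (\<lambda>t. u (g t))
      = Lp_class M p (\<lambda>t. \<Sum>y\<in>g ` space M. if g t = y then u y else 0)"
    using fin sum(1)
    by (intro Lp_class_cong simple_function_in_Lp_fun[OF M] simple_function_compose1[OF g]) auto
  with sum(2) show ?thesis by simp
qed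

section \<open>Ball huskability passes to the value space\<close>

theorem proposition3p1:
  fixes M :: "'w measure" and p :: real
  assumes "finite_measure M" and "0 < measure M (space M)"
    and "\<exists>x::'a::banach. x \<noteq> 0"
    and "1 \<le> p"
    and "BHP (Lp_space M p :: ('w \<Rightarrow> 'a) set normed_struct)"
  shows "BHP (type_space :: 'a normed_struct)"
proof (rule ccontr)
  interpret finite_measure M by fact
  note M = \<open>finite_measure M\<close>
  let ?L = "Lp_space M p :: ('w \<Rightarrow> 'a) set normed_struct"
  let ?m = "measure M (space M)"
  have "0 < p" using \<open>1 \<le> p\<close> by simp
  assume "\<not> BHP (type_space :: 'a normed_struct)"
  then obtain \<eta> where "0 < \<eta>" and separated:
    "\<And>(F :: ('a \<Rightarrow> real) set) x R \<delta>. \<lbrakk>finite F; \<And>\<psi>. \<psi> \<in> F \<Longrightarrow> bounded_linear \<psi>; norm x \<le> R; 0 < \<delta>\<rbrakk> \<Longrightarrow>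
      \<exists>u v. norm u \<le> R \<and> norm v \<le> R \<and> \<eta> * R \<le> norm (u - v) \<and>
        (\<forall>\<psi>\<in>F. \<bar>\<psi> u - \<psi> x\<bar> < \<delta> \<and> \<bar>\<psi> v - \<psi> x\<bar> < \<delta>)"
    by (rule not_BHP_separated_points) blast
  obtain W where W: "openin (subtopology (weak_topology ?L) (unit_ball ?L)) W" "W \<noteq> {}"
      "diameter_in ?L W < \<eta>"
    using \<open>BHP ?L\<close> \<open>0 < \<eta>\<close> unfolding BHP_def by blast
  then obtain T where T: "openin (weak_topology ?L) T" "W = T \<inter> unit_ball ?L"
    by (auto simp: openin_subtopology)
  obtain A where A: "A \<in> T" "A \<in> unit_ball ?L"
    using T(2) \<open>W \<noteq> {}\<close> by auto
  then obtain f where f: "f \<in> Lp_fun M p" "A = Lp_class M p f"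
    by (auto simp: unit_ball_def elim!: pts_Lp_space_cases)
  obtain F \<delta> where F: "finite F" "F \<subseteq> dual_in ?L" and "0 < \<delta>"
    and nhd: "\<forall>B\<in>pts ?L. (\<forall>\<phi>\<in>F. \<bar>\<phi> B - \<phi> A\<bar> < \<delta>) \<longrightarrow> B \<in> T"
    using openin_weak_topology_basic_nhd[OF T(1) A(1)] by (elim exE conjE) (rule that)

  have f_le: "(LINT t|M. norm (f t) powr p) \<le> 1"
    using A(2) f \<open>0 < p\<close> by (simp add: Lp_class_in_unit_ball_iff)
  obtain g where g: "simple_function M g" "\<And>t. norm (g t) \<le> norm (f t)"
    and g_near: "\<And>\<phi>. \<phi> \<in> F \<Longrightarrow> \<bar>\<phi> (Lp_class M p g) - \<phi> A\<bar> < \<delta> / 2"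
  proof -
    obtain s where s: "\<And>i. simple_function M (s i)" "\<And>i t. norm (s i t) \<le> norm (f t)"
      "(\<lambda>i. Lp_seminorm M p (\<lambda>t. s i t - f t)) \<longlonglongrightarrow> 0"
      using simple_functions_dense_below[OF f(1) \<open>0 < p\<close>] by blast
    have "\<forall>\<^sub>F i in sequentially. \<bar>\<phi> (Lp_class M p (s i)) - \<phi> A\<bar> < \<delta> / 2" if "\<phi> \<in> F" for \<phi>
    proof -
      have \<phi>: "\<phi> \<in> dual_in ?L" using that F by auto
      obtain K where K: "\<And>f. f \<in> Lp_fun M p \<Longrightarrow> \<bar>\<phi> (Lp_class M p f)\<bar> \<le> K * Lp_seminorm M p f"
        using dual_Lp_bounded[OF \<phi>] by blast
      have "(\<lambda>i. K * Lp_seminorm M p (\<lambda>t. s i t - f t)) \<longlonglongrightarrow> K * 0"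
        by (intro tendsto_mult_left s(3))
      then have "\<forall>\<^sub>F i in sequentially. K * Lp_seminorm M p (\<lambda>t. s i t - f t) < \<delta> / 2"
        using \<open>0 < \<delta>\<close> by (intro order_tendstoD(2)) auto
      then show ?thesis
      proof eventually_elim
        case (elim i)
        have si: "s i \<in> Lp_fun M p"
          by (rule simple_function_in_Lp_fun[OF M s(1)])
        have "\<phi> (Lp_class M p (s i)) - \<phi> A = \<phi> (Lp_class M p (\<lambda>t. s i t - f t))"
          using dual_Lp_diff[OF \<phi> si f(1)] \<open>0 < p\<close> f(2) by simp
        with K[OF Lp_fun_diff[OF si f(1)]] elim \<open>0 < p\<close> show ?case by simp
      qed
    qed
    then have "\<forall>\<^sub>F i in sequentially. \<forall>\<phi>\<in>F. \<bar>\<phi> (Lp_class M p (s i)) - \<phi> A\<bar> < \<delta> / 2"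
      using F(1) by (simp add: eventually_ball_finite)
    then obtain i where "\<forall>\<phi>\<in>F. \<bar>\<phi> (Lp_class M p (s i)) - \<phi> A\<bar> < \<delta> / 2"
      using eventually_happens'[OF sequentially_bot] by blast
    with s that[of "s i"] show ?thesis by blast
  qed
  have g_Lp: "g \<in> Lp_fun M p"
    by (rule simple_function_in_Lp_fun[OF M g(1)])
  then have g_int: "integrable M (\<lambda>t. norm (g t) powr p)"
    by (simp add: Lp_fun_def)
  have "(LINT t|M. norm (g t) powr p) \<le> (LINT t|M. norm (f t) powr p)"
    using f(1) g(2) g_int \<open>0 < p\<close> by (intro integral_mono powr_mono2) (auto simp: Lp_fun_def)
  with f_le have g_le: "(LINT t|M. norm (g t) powr p) \<le> 1" by simp

  define c where "c = (1 - (LINT t|M. norm (g t) powr p)) / ?m"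
  have "0 \<le> c" using g_le \<open>0 < ?m\<close> by (simp add: c_def)
  define R where "R y = (norm y powr p + c) powr (1 / p)" for y :: 'a
  have R_nonneg: "0 \<le> R y" for y by (simp add: R_def)
  have R_powr: "R y powr p = norm y powr p + c" for y
    using \<open>0 < p\<close> \<open>0 \<le> c\<close> by (simp add: R_def powr_powr)
  have norm_le_R: "norm y \<le> R y" for y
  proof -
    have "norm y = (norm y powr p) powr (1 / p)"
      using \<open>0 < p\<close> by (simp add: powr_powr)
    also have "\<dots> \<le> R y"
      unfolding R_def using \<open>0 < p\<close> \<open>0 \<le> c\<close> by (intro powr_mono2) auto
    finally show ?thesis .
  qed
  have R_int: "integrable M (\<lambda>t. R (g t) powr p)"
    unfolding R_powr using g_int by simp
  have R_integral: "(LINT t|M. R (g t) powr p) = 1"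
    unfolding R_powr using g_int \<open>0 < ?m\<close> by (simp add: c_def)

  let ?Y = "g ` space M"
  have "finite ?Y" using g(1) by (rule simple_functionD)
  \<comment> \<open>The errors at the values of \<open>g\<close> add up to less than half of \<open>\<delta>\<close>; the other half is spent on
      the passage from \<open>f\<close> to \<open>g\<close>.\<close>
  define \<gamma> where "\<gamma> = \<delta> / (2 * (real (card ?Y) + 1))"
  have "0 < \<gamma>" using \<open>0 < \<delta>\<close> by (simp add: \<gamma>_def)
  have \<gamma>_sum: "real (card ?Y) * \<gamma> < \<delta> / 2"
    using \<open>0 < \<delta>\<close> by (simp add: \<gamma>_def field_simps)
  define \<Psi> where "\<Psi> \<phi> y x = \<phi> (Lp_class M p (\<lambda>t. if g t = y then x else 0))"
    for \<phi> :: "('w \<Rightarrow> 'a) set \<Rightarrow> real" and y x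
  have "\<exists>u v. norm u \<le> R y \<and> norm v \<le> R y \<and> \<eta> * R y \<le> norm (u - v) \<and>
        (\<forall>\<psi>\<in>(\<lambda>\<phi>. \<Psi> \<phi> y) ` F. \<bar>\<psi> u - \<psi> y\<bar> < \<gamma> \<and> \<bar>\<psi> v - \<psi> y\<bar> < \<gamma>)" for y
    using F norm_le_R \<open>0 < \<gamma>\<close> dual_Lp_piece_bounded_linear[OF M _ \<open>0 < p\<close> g(1), of _ y]
    by (intro separated) (auto simp: \<Psi>_def [abs_def])
  then obtain u v where uR: "\<And>y. norm (u y) \<le> R y" and vR: "\<And>y. norm (v y) \<le> R y"
    and sep: "\<And>y. \<eta> * R y \<le> norm (u y - v y)"
    and u\<Psi>: "\<And>y \<phi>. \<phi> \<in> F \<Longrightarrow> \<bar>\<Psi> \<phi> y (u y) - \<Psi> \<phi> y y\<bar> < \<gamma>"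
    and v\<Psi>: "\<And>y \<phi>. \<phi> \<in> F \<Longrightarrow> \<bar>\<Psi> \<phi> y (v y) - \<Psi> \<phi> y y\<bar> < \<gamma>"
    by simp metis

  have Lp: "(\<lambda>t. w (g t)) \<in> Lp_fun M p" for w :: "'a \<Rightarrow> 'a"
    by (intro simple_function_in_Lp_fun[OF M] simple_function_compose1[OF g(1)])
  have in_W: "Lp_class M p (\<lambda>t. w (g t)) \<in> W"
    if wR: "\<And>y. norm (w y) \<le> R y"
      and w\<Psi>: "\<And>y \<phi>. \<phi> \<in> F \<Longrightarrow> \<bar>\<Psi> \<phi> y (w y) - \<Psi> \<phi> y y\<bar> < \<gamma>" for w
  proof -
    have "(LINT t|M. norm (w (g t)) powr p) \<le> (LINT t|M. R (g t) powr p)"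
      using Lp[of w] R_int wR \<open>0 < p\<close> by (intro integral_mono powr_mono2) (auto simp: Lp_fun_def)
    then have "Lp_class M p (\<lambda>t. w (g t)) \<in> unit_ball ?L"
      using Lp[of w] \<open>0 < p\<close> by (simp add: Lp_class_in_unit_ball_iff R_integral)
    moreover have "Lp_class M p (\<lambda>t. w (g t)) \<in> T"
    proof (rule nhd[rule_format])
      fix \<phi> assume "\<phi> \<in> F"
      then have \<phi>: "\<phi> \<in> dual_in ?L" using F by auto
      have "\<phi> (Lp_class M p (\<lambda>t. w (g t))) - \<phi> (Lp_class M p g)
          = (\<Sum>y\<in>?Y. \<Psi> \<phi> y (w y) - \<Psi> \<phi> y y)"
        using dual_Lp_simple_decomposition[OF M \<phi> \<open>0 < p\<close> g(1), of w]
          dual_Lp_simple_decomposition[OF M \<phi> \<open>0 < p\<close> g(1), of "\<lambda>y. y"]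
        by (simp add: \<Psi>_def sum_subtractf)
      also have "\<bar>\<dots>\<bar> \<le> (\<Sum>y\<in>?Y. \<bar>\<Psi> \<phi> y (w y) - \<Psi> \<phi> y y\<bar>)"
        by (rule sum_abs)
      also have "\<dots> \<le> real (card ?Y) * \<gamma>"
        using w\<Psi>[OF \<open>\<phi> \<in> F\<close>] by (intro sum_bounded_above) (simp add: less_imp_le)
      finally show "\<bar>\<phi> (Lp_class M p (\<lambda>t. w (g t))) - \<phi> A\<bar> < \<delta>"
        using \<gamma>_sum g_near[OF \<open>\<phi> \<in> F\<close>] by linarith
    qed (rule Lp_class_in_pts[OF Lp])
    ultimately show ?thesis by (simp add: T(2))
  qed

  have "\<eta> powr p = (LINT t|M. \<eta> powr p * R (g t) powr p)"
    by (simp add: R_integral)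
  also have "\<dots> \<le> (LINT t|M. norm (u (g t) - v (g t)) powr p)"
  proof (rule integral_mono)
    show "integrable M (\<lambda>t. norm (u (g t) - v (g t)) powr p)"
      using Lp[of "\<lambda>y. u y - v y"] by (simp add: Lp_fun_def)
    fix t
    have "(\<eta> * R (g t)) powr p \<le> norm (u (g t) - v (g t)) powr p"
      using sep \<open>0 < \<eta>\<close> \<open>0 < p\<close> R_nonneg by (intro powr_mono2) auto
    then show "\<eta> powr p * R (g t) powr p \<le> norm (u (g t) - v (g t)) powr p"
      using \<open>0 < \<eta>\<close> R_nonneg by (simp add: powr_mult)
  qed (use R_int in simp)
  finally have "(\<eta> powr p) powr (1 / p) \<le> Lp_seminorm M p (\<lambda>t. u (g t) - v (g t))"
    unfolding Lp_seminorm_def using \<open>0 < p\<close> by (intro powr_mono2) auto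
  then have "\<eta> \<le> dist_in ?L (Lp_class M p (\<lambda>t. u (g t))) (Lp_class M p (\<lambda>t. v (g t)))"
    using \<open>0 < \<eta>\<close> \<open>0 < p\<close> Lp[of u] Lp[of v] by (simp add: dist_in_Lp_space powr_powr)
  also have "\<dots> \<le> diameter_in ?L W"
    using in_W[OF uR u\<Psi>] in_W[OF vR v\<Psi>] T(2) \<open>0 < p\<close>
    by (intro dist_in_le_diameter_in_Lp_space) auto
  finally show False using W(3) by simp
qed

end
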